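(* Let $n\ge 1$, and let $f:R(\mathcal{HS}_{2n-1})\to\mathfrak S_n\times\mathfrak S_n$, $f(A)=(\sigma_A,\tau_A)$, be the bijection described in the context. Define the sign of a region $A\in R(\mathcal{HS}_{2n-1})$ by $\varepsilon(A)=\operatorname{sgn}(\sigma_A)\operatorname{sgn}(\tau_A)$. Then $$\sum_{A\in R(\mathcal{HS}_{2n-1})}\varepsilon(A)\,t^{\operatorname{cyc}(\sigma_A)+\operatorname{cyc}(\tau_A)-1}=t\prod_{i=1}^{n-1}(t-i)^2.$$
   Context: $\mathcal{HS}_{2n-1}$ is the hyperplane arrangement in $\mathbb R^{2n-1}$ with coordinates $(\mathbf x,\mathbf y)=(x_1,\dots,x_n,y_1,\dots,y_{n-1})$ given by $\{x_i-x_j=0:1\le i<j\le n\}\cup\{x_i-x_j=y_i:1\le i<j\le n\}$. $R(\mathcal{HS}_{2n-1})$ is its set of regions (connected components of the complement in $\mathbb R^{2n-1}$ of the union of the hyperplanes). The map $f$: for a region $A$, $\sigma_A\in\mathfrak S_n$ is the unique permutation with $x_{\sigma_A(1)}<x_{\sigma_A(2)}<\cdots<x_{\sigma_A(n)}$ for all $(\mathbf x,\mathbf y)\in A$. For $1\le i<n$ put $\ell_i(A)=\#\{j>i:y_i>x_i-x_j\}$ (the same for all points of $A$), and $\ell_n(A)=0$, so $0\le\ell_i(A)\le n-i$. Then $\tau_A\in\mathfrak S_n$ is the permutation with Lehmer code $(\ell_1(A),\dots,\ell_n(A))$, i.e. $\tau_A(i)$ is the $(\ell_i(A)+1)$-th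 smallest element of $\{1,\dots,n\}\setminus\{\tau_A(1),\dots,\tau_A(i-1)\}$. Here $\operatorname{cyc}(\pi)$ denotes the number of cycles of $\pi\in\mathfrak S_n$ (including fixed points) and $\operatorname{sgn}$ the sign of a permutation. *)

theory Defs
  imports
    "HOL-Analysis.Analysis"
    "HOL-Combinatorics.Permutations"
    "HOL-Combinatorics.Orbits"
    "HOL-Computational_Algebra.Polynomial"
begin

text \<open>
  A point of \<open>\<real>\<^bsup>2n-1\<^esup>\<close> is a point \<open>p\<close> of \<^term>\<open>Euclidean_space (2 * n - 1)\<close>, whose coordinates are
  numbered from 0: \<open>x\<^sub>1, \<dots>, x\<^sub>n\<close> are \<open>p 0, \<dots>, p (n - 1)\<close>, and
  \<open>y\<^sub>1, \<dots>, y\<^bsub>n-1\<^esub>\<close> are \<open>p n, \<dots>, p (2 * n - 2)\<close>.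
  The index \<open>i\<close> below starts from 1, as in the usual notation.
\<close>

definition xcoord :: "(nat \<Rightarrow> real) \<Rightarrow> nat \<Rightarrow> real" where
  "xcoord p i = p (i - 1)"

definition ycoord :: "nat \<Rightarrow> (nat \<Rightarrow> real) \<Rightarrow> nat \<Rightarrow> real" where
  "ycoord n p i = p (n + i - 1)"

definition HS_arrangement :: "nat \<Rightarrow> (nat \<Rightarrow> real) set set" where
  "HS_arrangement n =
     {{p \<in> topspace (Euclidean_space (2 * n - 1)). xcoord p i - xcoord p j = 0} | i j.
        1 \<le> i \<and> i < j \<and> j \<le> n} \<union>
     {{p \<in> topspace (Euclidean_space (2 * n - 1)). xcoord p i - xcoord p j = ycoord n p i} | i j.
        1 \<le> i \<and> i < j \<and> j \<le> n}"

definition HS_regions :: "nat \<Rightarrow> (nat \<Rightarrow> real) set set" where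
  "HS_regions n = connected_components_of
     (subtopology (Euclidean_space (2 * n - 1))
        (topspace (Euclidean_space (2 * n - 1)) - \<Union>(HS_arrangement n)))"

definition region_sigma :: "nat \<Rightarrow> (nat \<Rightarrow> real) set \<Rightarrow> nat \<Rightarrow> nat" where
  "region_sigma n A = (THE \<sigma>. \<sigma> permutes {1..n} \<and>
     (\<forall>p\<in>A. \<forall>i j. 1 \<le> i \<and> i < j \<and> j \<le> n \<longrightarrow> xcoord p (\<sigma> i) < xcoord p (\<sigma> j)))"

definition region_ell :: "nat \<Rightarrow> (nat \<Rightarrow> real) set \<Rightarrow> nat \<Rightarrow> nat" where
  "region_ell n A i =
     (if 1 \<le> i \<and> i < n
      then THE l. \<forall>p\<in>A. l = card {j. i < j \<and> j \<le> n \<and> ycoord n p i > xcoord p i - xcoord p j}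
      else 0)"

text \<open>
  List positions are counted from 0, so \<open>sorted_list_of_set S ! k\<close> is the \<open>(k + 1)\<close>-th smallest
  element of the finite set \<open>S\<close>.
\<close>

definition perm_of_lehmer_code :: "nat \<Rightarrow> (nat \<Rightarrow> nat) \<Rightarrow> nat \<Rightarrow> nat" where
  "perm_of_lehmer_code n c = (THE \<tau>. \<tau> permutes {1..n} \<and>
     (\<forall>i\<in>{1..n}. \<tau> i = sorted_list_of_set ({1..n} - \<tau> ` {1..<i}) ! c i))"

definition region_tau :: "nat \<Rightarrow> (nat \<Rightarrow> real) set \<Rightarrow> nat \<Rightarrow> nat" where
  "region_tau n A = perm_of_lehmer_code n (region_ell n A)"

definition region_map :: "nat \<Rightarrow> (nat \<Rightarrow> real) set \<Rightarrow> (nat \<Rightarrow> nat) \<times> (nat \<Rightarrow> nat)" where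
  "region_map n A = (region_sigma n A, region_tau n A)"

definition region_sign :: "nat \<Rightarrow> (nat \<Rightarrow> real) set \<Rightarrow> int" where
  "region_sign n A = (case region_map n A of (\<sigma>, \<tau>) \<Rightarrow> sign \<sigma> * sign \<tau>)"

text \<open>
  The cycles of a permutation of \<open>{1..n}\<close> correspond to its orbits on \<open>{1..n}\<close>; a fixed point is
  an orbit with one element.
\<close>

definition cyc :: "nat \<Rightarrow> (nat \<Rightarrow> nat) \<Rightarrow> nat" where
  "cyc n \<pi> = card (orbit \<pi> ` {1..n})"

end

theory Submission
  imports Defs
begin

text \<open>
  Since each hyperplane is the zero set of a linear form, two points of the complement lie in the
  same region iff all these forms have the same signs at both: signs are constant on connected sets,
  and the segment between two points with equal signs stays in the complement. The signs of the
  \<open>x\<^sub>i - x\<^sub>j\<close> amount to \<open>\<sigma>\<close>. Given \<open>\<sigma>\<close>, the set of \<open>j > i\<close> with \<open>x\<^sub>j > x\<^sub>i - y\<^sub>i\<close> is an upper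
  set of a fixed linear order, hence is determined by its cardinality \<open>\<ell>\<^sub>i\<close>, which can take any
  value from 0 to \<open>n - i\<close>. As Lehmer codes biject with permutations, the regions biject with pairs
  \<open>(\<sigma>, \<tau>)\<close>, and \<open>t\<close> times the sum is the square of
  \<open>\<Sum>\<^sub>\<sigma> sgn(\<sigma>) t\<^bsup>cyc(\<sigma>)\<^esup> = t (t - 1) \<dots> (t - n + 1)\<close>. The latter follows by induction on \<open>n\<close>:
  a new point either becomes a fixed point (factor \<open>t\<close>) or is inserted into an existing
  cycle at one of \<open>n\<close> places, which flips the sign and keeps the number of cycles (factor \<open>- n\<close>).
\<close>

section \<open>Signed enumeration of permutations by cycles\<close>

text \<open>Composing with the transposition reroutes the arrow into \<open>b\<close> through
  \<open>a\<close>: the \<open>p\<close>-preimage of \<open>b\<close> now goes to \<open>a\<close>,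
  and \<open>a\<close> goes to \<open>b\<close>. Thus \<open>a\<close> is spliced into the cycle of
  \<open>b\<close>, and the points of \<open>S\<close> are still visited in the same order.\<close>

lemma orbit_transpose_comp_iff:
  assumes p: "p permutes S" and a: "a \<notin> S" and b: "b \<in> S" and x: "x \<in> S" and y: "y \<in> S"
  shows "y \<in> orbit (Transposition.transpose a b \<circ> p) x \<longleftrightarrow> y \<in> orbit p x"
proof
  let ?q = "Transposition.transpose a b \<circ> p"
  have qa: "?q a = b"
    using p a by (simp add: permutes_not_in)
  have qx: "?q z = (if p z = b then a else p z)" if "z \<in> S" for z
    using permutes_in_image[OF p, of z] that a by (auto simp: Transposition.transpose_def)
  have inS: "z \<in> S" if "z \<in> orbit p x" for z
    using permutes_orbit_subset[OF p x] that by blast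
  have q_step: "?q z \<in> orbit p x \<or> (?q z = a \<and> b \<in> orbit p x)" if "z \<in> orbit p x \<or> z = x" for z
  proof -
    have "p z \<in> orbit p x" "z \<in> S"
      using that inS x orbit.step[of z p x] orbit.base[of p x] by auto
    then show ?thesis
      using qx[of z] by presburger
  qed
  \<comment> \<open>The invariant must allow a visit to \<open>a\<close> and remember that
    \<open>b\<close> lies in the old orbit, since the next step leads from \<open>a\<close> to
    \<open>b\<close>.\<close>
  have "z \<in> orbit p x \<or> (z = a \<and> b \<in> orbit p x)" if "z \<in> orbit ?q x" for z
    using that
  proof induction
    case base
    then show ?case using q_step by blast
  next
    case (step z)
    then show ?case using q_step[of z] qa by metis
  qed
  then show "y \<in> orbit p x" if "y \<in> orbit ?q x"
    using that y a by blast
  \<comment> \<open>Conversely, a step of \<open>p\<close> is one step of \<open>?q\<close>, or two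
    via \<open>a\<close> if it ends in \<open>b\<close>.\<close>
  have p_step: "p z \<in> orbit ?q x" if "z \<in> S" "z = x \<or> z \<in> orbit ?q x" for z
  proof -
    have "?q z \<in> orbit ?q x"
      using that orbit.base[of ?q x] orbit.step[of z ?q x] by auto
    then show ?thesis
      using qx[OF that(1)] qa orbit.step[of a ?q x] by (cases "p z = b") auto
  qed
  show "y \<in> orbit ?q x" if "y \<in> orbit p x"
    using that
  proof induction
    case base
    then show ?case using p_step x by blast
  next
    case (step z)
    then show ?case using p_step inS by blast
  qed
qed

lemma orbit_eq_iff_mem:
  assumes "permutation p"
  shows "orbit p x = orbit p y \<longleftrightarrow> y \<in> orbit p x"
  using orbit_cyclic_eq3[OF cyclic_on_orbit'[OF assms], of y x] permutation_self_in_orbit[OF assms] by blast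

text \<open>Meant for orbits of two permutations: the orbits differ as sets, but they induce the
  same partition of \<open>S\<close>, and only the partition matters for counting.\<close>

lemma card_image_eq_of_same_fibres:
  assumes "\<And>x y. x \<in> S \<Longrightarrow> y \<in> S \<Longrightarrow> f x = f y \<longleftrightarrow> g x = g y"
  shows "card (f ` S) = card (g ` S)"
proof (rule bij_betw_same_card)
  let ?h = "\<lambda>v. g (inv_into S f v)"
  have h: "?h (f x) = g x" if "x \<in> S" for x
    using that assms by (metis f_inv_into_f image_eqI inv_into_into)
  show "bij_betw ?h (f ` S) (g ` S)"
    unfolding bij_betw_def inj_on_def image_image using h assms by (auto simp: image_iff)
qed

text \<open>The point \<open>a\<close> joins the orbit of \<open>b\<close>, so no orbit is
  added.\<close>

lemma card_orbits_transpose_comp: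
  assumes S: "finite S" and p: "p permutes S" and a: "a \<notin> S" and b: "b \<in> S"
  shows "card (orbit (Transposition.transpose a b \<circ> p) ` insert a S) = card (orbit p ` S)"
proof -
  let ?q = "Transposition.transpose a b \<circ> p"
  have q: "?q permutes insert a S"
    using b p by (intro permutes_compose permutes_swap_id permutes_subset[OF p]) auto
  have perm: "permutation ?q" "permutation p"
    using S p q by (meson finite.insertI permutation_permutes)+
  have "?q a = b"
    using p a by (simp add: permutes_not_in)
  then have "orbit ?q a = orbit ?q b"
    by (metis orbit.base orbit_eq_iff_mem perm(1))
  then have "orbit ?q ` insert a S = orbit ?q ` S"
    using b by auto
  also have "card \<dots> = card (orbit p ` S)"
    by (intro card_image_eq_of_same_fibres)
       (simp only: orbit_eq_iff_mem perm orbit_transpose_comp_iff[OF p a b])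
  finally show ?thesis .
qed

lemma card_orbits_fixed_insert:
  assumes S: "finite S" and p: "p permutes S" and a: "a \<notin> S"
  shows "card (orbit p ` insert a S) = Suc (card (orbit p ` S))"
proof -
  have "orbit p a \<notin> orbit p ` S"
  proof
    assume "orbit p a \<in> orbit p ` S"
    then obtain x where "x \<in> S" "a \<in> orbit p x"
      using orbit.base[of p a] p a by (auto simp: permutes_not_in)
    then show False
      using permutes_orbit_subset[OF p] a by blast
  qed
  then show ?thesis
    using S by simp
qed

lemma sum_sign_monom_card_orbits:
  assumes "finite S"
  shows "(\<Sum>p | p permutes S. monom (sign p) (card (orbit p ` S)))
    = (\<Prod>i<card S. monom 1 1 - [:int i:])"
  using assms
proof (induction S rule: finite_induct)
  case empty
  have "{p. p permutes ({} :: 'a set)} = {id}"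
    by (auto simp: permutes_empty)
  then show ?case
    by simp
next
  case (insert a S)
  let ?F = "\<Sum>p | p permutes S. monom (sign p) (card (orbit p ` S))"
  have fixed: "monom (sign p) (card (orbit p ` insert a S))
      = monom 1 1 * monom (sign p) (card (orbit p ` S))" if "p permutes S" for p
    using card_orbits_fixed_insert[OF insert.hyps(1) that insert.hyps(2)]
    by (simp add: mult_monom)
  have moved: "monom (sign (Transposition.transpose a b \<circ> p)) (card (orbit (Transposition.transpose a b \<circ> p) ` insert a S))
      = - monom (sign p) (card (orbit p ` S))" if "p permutes S" "b \<in> S" for p b
  proof -
    have "permutation p"
      using insert.hyps(1) that(1) permutation_permutes by blast
    then have "sign (Transposition.transpose a b \<circ> p) = - sign p"
      using that insert.hyps(2)
      by (auto simp: sign_compose permutation_swap_id sign_swap_id)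
    then show ?thesis
      using card_orbits_transpose_comp[OF insert.hyps(1) that(1) insert.hyps(2) that(2)]
      by (simp add: minus_monom)
  qed
  \<comment> \<open>Every permutation of \<open>insert a S\<close> is
    \<open>transpose a b \<circ> p\<close> for unique \<open>b \<in> insert a S\<close> and
    \<open>p\<close> permuting \<open>S\<close>. The case \<open>b = a\<close> gives the
    permutations that fix \<open>a\<close>.\<close>
  have "(\<Sum>p | p permutes insert a S. monom (sign p) (card (orbit p ` insert a S)))
      = (\<Sum>p | p permutes S. monom (sign p) (card (orbit p ` insert a S)))
        + (\<Sum>b\<in>S. \<Sum>p | p permutes S.
            monom (sign (Transposition.transpose a b \<circ> p)) (card (orbit (Transposition.transpose a b \<circ> p) ` insert a S)))"
    using insert.hyps by (simp add: sum_over_permutations_insert id_def[symmetric])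
  also have "(\<Sum>p | p permutes S. monom (sign p) (card (orbit p ` insert a S))) = monom 1 1 * ?F"
    unfolding sum_distrib_left using fixed by (intro sum.cong) blast+
  also have "(\<Sum>b\<in>S. \<Sum>p | p permutes S.
      monom (sign (Transposition.transpose a b \<circ> p)) (card (orbit (Transposition.transpose a b \<circ> p) ` insert a S)))
      = (\<Sum>b\<in>S. - ?F)"
    unfolding sum_negf[symmetric] using moved by (intro sum.cong) blast+
  also have "\<dots> = - [:int (card S):] * ?F"
    by (simp add: of_nat_poly)
  also have "monom 1 1 * ?F + - [:int (card S):] * ?F = (\<Prod>i<card (insert a S). monom 1 1 - [:int i:])"
    unfolding insert.IH card_insert_disjoint[OF insert.hyps] prod.lessThan_Suc
    by (simp only: mult.commute[of _ "monom 1 1 - _"] left_diff_distrib mult_minus_left add_uminus_conv_diff)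
  finally show ?case .
qed

section \<open>Lehmer codes\<close>

text \<open>The condition under the definite description in \<open>perm_of_lehmer_code\<close>,
  isolated so that existence and uniqueness can be treated separately. It puts no bound on
  \<open>c\<close>; where \<open>c i \<le> n - i\<close> matters, it is assumed.\<close>

definition has_lehmer_code :: "nat \<Rightarrow> (nat \<Rightarrow> nat) \<Rightarrow> (nat \<Rightarrow> nat) \<Rightarrow> bool" where
  "has_lehmer_code n c \<tau> \<longleftrightarrow> \<tau> permutes {1..n} \<and>
     (\<forall>i\<in>{1..n}. \<tau> i = sorted_list_of_set ({1..n} - \<tau> ` {1..<i}) ! c i)"

lemma card_Diff_image_permutes:
  assumes "\<tau> permutes {1..n}" "i \<in> {1..n}"
  shows "card ({1..n} - \<tau> ` {1..<i}) = Suc (n - i)"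
proof -
  have "\<tau> ` {1..<i} \<subseteq> {1..n}"
    using permutes_image[OF assms(1)] image_mono[of "{1..<i}" "{1..n}" \<tau>] assms(2) by fastforce
  moreover have "card (\<tau> ` {1..<i}) = i - 1"
    by (simp add: card_image permutes_inj_on[OF assms(1)])
  ultimately show ?thesis
    using assms(2) by (auto simp: card_Diff_subset)
qed

lemma has_lehmer_code_permutes: "has_lehmer_code n c \<tau> \<Longrightarrow> \<tau> permutes {1..n}"
  unfolding has_lehmer_code_def by blast

lemma has_lehmer_code_nth:
  assumes "has_lehmer_code n c \<tau>" "i \<in> {1..n}"
  shows "\<tau> i = sorted_list_of_set ({1..n} - \<tau> ` {1..<i}) ! c i"
  using assms unfolding has_lehmer_code_def by blast

lemma has_lehmer_code_cong:
  assumes "\<And>i. i \<in> {1..n} \<Longrightarrow> c i = c' i"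
  shows "has_lehmer_code n c \<tau> \<longleftrightarrow> has_lehmer_code n c' \<tau>"
  unfolding has_lehmer_code_def by (simp only: assms cong: ball_cong)

text \<open>Each value is computed from the code and the earlier values, so strong induction
  applies; outside \<open>{1..n}\<close> both permutations are the identity.\<close>

lemma has_lehmer_code_unique:
  assumes "has_lehmer_code n c \<tau>" "has_lehmer_code n c \<tau>'"
  shows "\<tau> = \<tau>'"
proof
  fix i
  show "\<tau> i = \<tau>' i"
  proof (induction i rule: less_induct)
    case (less i)
    then have "\<tau> ` {1..<i} = \<tau>' ` {1..<i}"
      by (intro image_cong) auto
    then show ?case
      using assms[THEN has_lehmer_code_nth, of i] assms[THEN has_lehmer_code_permutes, THEN permutes_not_in, of i]
      by metis
  qed
qed

lemma has_lehmer_code_inj: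
  assumes "has_lehmer_code n c \<tau>" "has_lehmer_code n c' \<tau>" "i \<in> {1..n}" "c i \<le> n - i" "c' i \<le> n - i"
  shows "c i = c' i"
proof -
  let ?L = "sorted_list_of_set ({1..n} - \<tau> ` {1..<i})"
  have "?L ! c i = ?L ! c' i"
    using assms(1,2)[THEN has_lehmer_code_nth, OF assms(3)] by simp
  moreover have "length ?L = Suc (n - i)"
    using card_Diff_image_permutes[of \<tau> n i] assms(1,3) has_lehmer_code_permutes by simp
  ultimately show ?thesis
    using assms(4,5) nth_eq_iff_index_eq[of ?L "c i" "c' i"] by (metis distinct_sorted_list_of_set less_Suc_eq_le)
qed

lemma ex_lehmer_code:
  assumes "\<tau> permutes {1..n}"
  shows "\<exists>c \<in> (\<Pi>\<^sub>E i\<in>{1..n}. {..n - i}). has_lehmer_code n c \<tau>"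
proof -
  have "\<exists>k \<le> n - i. \<tau> i = sorted_list_of_set ({1..n} - \<tau> ` {1..<i}) ! k" if "i \<in> {1..n}" for i
  proof -
    have "\<tau> i \<notin> \<tau> ` {1..<i}"
      by (simp add: inj_image_mem_iff[OF permutes_inj[OF assms]])
    then have "\<tau> i \<in> set (sorted_list_of_set ({1..n} - \<tau> ` {1..<i}))"
      using permutes_in_image[OF assms, of i] that by simp
    then show ?thesis
      using card_Diff_image_permutes[OF assms that]
      by (metis in_set_conv_nth length_sorted_list_of_set less_Suc_eq_le)
  qed
  then obtain c where c: "\<forall>i\<in>{1..n}. c i \<le> n - i \<and> \<tau> i = sorted_list_of_set ({1..n} - \<tau> ` {1..<i}) ! c i"
    using bchoice[of "{1..n}" "\<lambda>i k. k \<le> n - i \<and> \<tau> i = sorted_list_of_set ({1..n} - \<tau> ` {1..<i}) ! k"] by blast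
  then have "has_lehmer_code n c \<tau>"
    using assms unfolding has_lehmer_code_def by blast
  then have "has_lehmer_code n (restrict c {1..n}) \<tau>"
    by (rule has_lehmer_code_cong[THEN iffD1, rotated]) simp
  moreover have "restrict c {1..n} \<in> (\<Pi>\<^sub>E i\<in>{1..n}. {..n - i})"
    using c by (intro restrict_PiE_iff[THEN iffD2]) blast
  ultimately show ?thesis
    by blast
qed

lemma card_lehmer_codes: "card (\<Pi>\<^sub>E i\<in>{1..n}. {..n - i}) = fact n"
proof -
  have "card (\<Pi>\<^sub>E i\<in>{1..n}. {..n - i}) = (\<Prod>i\<in>{1..n}. Suc (n - i))"
    by (simp add: card_PiE)
  also have "\<dots> = \<Prod>{1..n}"
    \<comment> \<open>Reversing the index by \<open>n + 1 - i\<close> turns the factors into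
      \<open>1, \<dots>, n\<close>.\<close>
    by (rule prod.reindex_bij_witness[of _ "\<lambda>i. Suc (n - i)" "\<lambda>i. Suc (n - i)"]) auto
  finally show ?thesis
    by (simp add: fact_prod)
qed

text \<open>There are \<open>n!\<close> codes and \<open>n!\<close> permutations, so injectivity suffices for surjectivity.\<close>

lemma ex_has_lehmer_code:
  assumes "\<And>i. i \<in> {1..n} \<Longrightarrow> c i \<le> n - i"
  shows "\<exists>\<tau>. has_lehmer_code n c \<tau>"
proof -
  let ?P = "{\<tau>. \<tau> permutes {1..n}}" and ?C = "\<Pi>\<^sub>E i\<in>{1..n}. {..n - i}"
  have "\<forall>\<tau>\<in>?P. \<exists>c. c \<in> ?C \<and> has_lehmer_code n c \<tau>"
    using ex_lehmer_code[of _ n] by blast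
  from bchoice[OF this] obtain L where L: "\<forall>\<tau>\<in>?P. L \<tau> \<in> ?C \<and> has_lehmer_code n (L \<tau>) \<tau>"
    by blast
  have "inj_on L ?P"
  proof (rule inj_onI)
    fix \<tau> \<tau>' assume "\<tau> \<in> ?P" "\<tau>' \<in> ?P" "L \<tau> = L \<tau>'"
    then show "\<tau> = \<tau>'"
      using has_lehmer_code_unique L by metis
  qed
  then have "card (L ` ?P) = card ?C"
    by (simp only: card_image card_lehmer_codes card_permutations[of _ n] card_atLeastAtMost finite_atLeastAtMost diff_Suc_1)
  moreover have "finite ?C" "L ` ?P \<subseteq> ?C"
    using L by (blast intro: finite_PiE)+
  ultimately have "L ` ?P = ?C"
    by (metis card_subset_eq)
  moreover have "restrict c {1..n} \<in> ?C"
  proof (rule restrict_PiE_iff[THEN iffD2], rule ballI)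
    show "c i \<in> {..n - i}" if "i \<in> {1..n}" for i
      unfolding atMost_iff using that by (rule assms)
  qed
  ultimately have "restrict c {1..n} \<in> L ` ?P"
    by (simp only:)
  then obtain \<tau> where \<tau>: "\<tau> \<in> ?P" "restrict c {1..n} = L \<tau>"
    by (rule imageE)
  then have "has_lehmer_code n (restrict c {1..n}) \<tau>"
    using L by (simp only:)
  then have "has_lehmer_code n c \<tau>"
    by (rule has_lehmer_code_cong[THEN iffD1, rotated]) simp
  then show ?thesis
    by blast
qed

lemma has_lehmer_code_perm_of_lehmer_code:
  assumes "\<And>i. i \<in> {1..n} \<Longrightarrow> c i \<le> n - i"
  shows "has_lehmer_code n c (perm_of_lehmer_code n c)"
proof -
  have "\<exists>!\<tau>. has_lehmer_code n c \<tau>"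
    using ex_has_lehmer_code[OF assms] has_lehmer_code_unique by blast
  then show ?thesis
    unfolding perm_of_lehmer_code_def has_lehmer_code_def[symmetric] by (rule theI')
qed

section \<open>Sorting permutations\<close>

text \<open>The requirement of \<open>region_sigma\<close> at a single point, with \<open>f\<close>
  in the role of the \<open>x\<close>-coordinates.\<close>

definition sorting_permutation :: "nat \<Rightarrow> (nat \<Rightarrow> real) \<Rightarrow> (nat \<Rightarrow> nat) \<Rightarrow> bool" where
  "sorting_permutation n f \<sigma> \<longleftrightarrow> \<sigma> permutes {1..n} \<and>
     (\<forall>i j. 1 \<le> i \<and> i < j \<and> j \<le> n \<longrightarrow> f (\<sigma> i) < f (\<sigma> j))"

lemma sorting_permutation_permutes: "sorting_permutation n f \<sigma> \<Longrightarrow> \<sigma> permutes {1..n}"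
  unfolding sorting_permutation_def by blast

lemma sorting_permutation_mono:
  "sorting_permutation n f \<sigma> \<Longrightarrow> 1 \<le> i \<Longrightarrow> i < j \<Longrightarrow> j \<le> n \<Longrightarrow> f (\<sigma> i) < f (\<sigma> j)"
  unfolding sorting_permutation_def by blast

lemma ex_sorting_permutation:
  assumes inj: "inj_on f {1..n}"
  shows "\<exists>\<sigma>. sorting_permutation n f \<sigma>"
proof -
  define L where "L = sorted_list_of_set (f ` {1..n})"
  have len: "length L = n"
    unfolding L_def length_sorted_list_of_set card_image[OF inj] by simp
  have L_less: "L ! (i - 1) < L ! (j - 1)" if "1 \<le> i" "i < j" "j \<le> n" for i j
  proof (rule sorted_wrt_nth_less)
    show "sorted_wrt (<) L"
      unfolding L_def by (rule strict_sorted_list_of_set)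
  qed (use that len in auto)
  \<comment> \<open>The index whose value is the \<open>i\<close>-th smallest. List positions start
    from 0, hence \<open>i - 1\<close>; outside \<open>{1..n}\<close> a permutation of
    \<open>{1..n}\<close> has to be the identity.\<close>
  define \<sigma> where "\<sigma> i = (if i \<in> {1..n} then inv_into {1..n} f (L ! (i - 1)) else i)" for i
  have L_in: "L ! (i - 1) \<in> f ` {1..n}" if "i \<in> {1..n}" for i
  proof -
    have "i - 1 < length L"
      using that len by auto
    then have "L ! (i - 1) \<in> set L"
      by (rule nth_mem)
    then show ?thesis
      by (simp add: L_def)
  qed
  have f\<sigma>: "f (\<sigma> i) = L ! (i - 1)" and \<sigma>_in: "\<sigma> i \<in> {1..n}" if "i \<in> {1..n}" for i
    using f_inv_into_f[OF L_in[OF that]] inv_into_into[OF L_in[OF that]] that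
    by (simp_all add: \<sigma>_def)
  have mono: "f (\<sigma> i) < f (\<sigma> j)" if "1 \<le> i" "i < j" "j \<le> n" for i j
    using L_less[OF that] f\<sigma>[of i] f\<sigma>[of j] that by simp
  have "inj_on \<sigma> {1..n}"
    by (rule linorder_inj_onI) (use mono in fastforce)+
  then have "\<sigma> permutes {1..n}"
    using \<sigma>_in by (intro inj_imp_permutes) (auto simp: \<sigma>_def)
  then show ?thesis
    using mono unfolding sorting_permutation_def by blast
qed

text \<open>The number \<open>inv \<sigma> k\<close> is the rank of \<open>k\<close> by
  \<open>f\<close>. The converse implication follows because ranks are linearly ordered and equal
  ranks force \<open>i = j\<close>.\<close>

lemma sorting_permutation_less_iff:
  assumes sort: "sorting_permutation n f \<sigma>"
    and ij: "i \<in> {1..n}" "j \<in> {1..n}"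
  shows "f i < f j \<longleftrightarrow> inv \<sigma> i < inv \<sigma> j"
proof -
  note \<sigma> = sorting_permutation_permutes[OF sort]
  have in_n: "inv \<sigma> k \<in> {1..n}" if "k \<in> {1..n}" for k
    using permutes_in_image[OF permutes_inv[OF \<sigma>], of k] that by simp
  have \<sigma>_inv: "\<sigma> (inv \<sigma> k) = k" for k
    using \<sigma> by (rule permutes_inverses)
  have less: "f k < f l" if "k \<in> {1..n}" "l \<in> {1..n}" "inv \<sigma> k < inv \<sigma> l" for k l
    using sorting_permutation_mono[OF sort, of "inv \<sigma> k" "inv \<sigma> l"] in_n[OF that(1)] in_n[OF that(2)] that(3) by (simp add: \<sigma>_inv)
  show ?thesis
    using less[OF ij] less[OF ij(2,1)] \<sigma>_inv[of i] \<sigma>_inv[of j]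
    by (metis less_asym less_irrefl linorder_neqE_nat)
qed

text \<open>Expresses the rank through \<open>f\<close> alone, which yields uniqueness of the
  sorting permutation.\<close>

lemma sorting_permutation_card:
  assumes sort: "sorting_permutation n f \<sigma>"
    and i: "i \<in> {1..n}"
  shows "card {j \<in> {1..n}. f j < f i} = inv \<sigma> i - 1"
proof -
  note \<sigma> = sorting_permutation_permutes[OF sort]
  have "{j \<in> {1..n}. f j < f i} = {j \<in> {1..n}. inv \<sigma> j < inv \<sigma> i}"
    using sorting_permutation_less_iff[OF sort _ i] by blast
  also have "\<dots> = \<sigma> ` {1..<inv \<sigma> i}"
  proof (intro equalityI subsetI)
    fix j assume "j \<in> {j \<in> {1..n}. inv \<sigma> j < inv \<sigma> i}"
    then have "inv \<sigma> j \<in> {1..<inv \<sigma> i}"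
      using permutes_in_image[OF permutes_inv[OF \<sigma>], of j] by simp
    then show "j \<in> \<sigma> ` {1..<inv \<sigma> i}"
      using permutes_inverses(1)[OF \<sigma>, of j] by (metis imageI)
  next
    fix j assume "j \<in> \<sigma> ` {1..<inv \<sigma> i}"
    then obtain k where k: "j = \<sigma> k" "1 \<le> k" "k < inv \<sigma> i"
      by auto
    then have "k \<in> {1..n}"
      using permutes_in_image[OF permutes_inv[OF \<sigma>], of i] i by simp
    then show "j \<in> {j \<in> {1..n}. inv \<sigma> j < inv \<sigma> i}"
      using k permutes_in_image[OF \<sigma>, of k] permutes_inverses(2)[OF \<sigma>, of k] by simp
  qed
  finally show ?thesis
    by (simp add: card_image permutes_inj_on[OF \<sigma>])
qed

lemma sorting_permutation_unique:
  assumes sort: "sorting_permutation n f \<sigma>"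
    and sort': "sorting_permutation n f \<sigma>'"
  shows "\<sigma> = \<sigma>'"
proof -
  note \<sigma> = sorting_permutation_permutes[OF sort] and \<sigma>' = sorting_permutation_permutes[OF sort']
  have "inv \<sigma> i = inv \<sigma>' i" for i
  proof (cases "i \<in> {1..n}")
    case True
    \<comment> \<open>Truncated subtraction of 1 is injective only on positive numbers.\<close>
    have "1 \<le> inv \<sigma> i" "1 \<le> inv \<sigma>' i"
      using True permutes_in_image[OF permutes_inv[OF \<sigma>], of i]
        permutes_in_image[OF permutes_inv[OF \<sigma>'], of i] by simp_all
    then show ?thesis
      using sorting_permutation_card[OF sort True] sorting_permutation_card[OF sort' True] by simp
  next
    case False
    then show ?thesis
      using permutes_not_in[OF permutes_inv[OF \<sigma>]] permutes_not_in[OF permutes_inv[OF \<sigma>']] by metis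
  qed
  then have "inv \<sigma> = inv \<sigma>'" ..
  then show ?thesis
    by (metis \<sigma> \<sigma>' permutes_inv_inv)
qed

section \<open>Regions as sign classes\<close>

text \<open>Start above all of \<open>S\<close> and lower the threshold past one element at a time.
  This is used to choose the \<open>y\<close>-coordinates of a point with a prescribed code.\<close>

lemma ex_threshold:
  fixes S :: "real set"
  assumes S: "finite S" and l: "l \<le> card S"
  shows "\<exists>\<theta>. \<theta> \<notin> S \<and> card {s \<in> S. \<theta> < s} = l"
  using l
proof (induction l)
  case 0
  \<comment> \<open>The inserted 0 keeps the maximum meaningful for empty \<open>S\<close>.\<close>
  have "s \<le> Max (insert 0 S)" if "s \<in> S" for s
    using S that by simp
  then have less: "s < Max (insert 0 S) + 1" if "s \<in> S" for s
    using that by fastforce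
  then have "{s \<in> S. Max (insert 0 S) + 1 < s} = {}"
    by fastforce
  then have "card {s \<in> S. Max (insert 0 S) + 1 < s} = 0"
    by (simp only: card.empty)
  with less show ?case by blast
next
  case (Suc l)
  then obtain \<theta> where \<theta>: "\<theta> \<notin> S" "card {s \<in> S. \<theta> < s} = l"
    by auto
  \<comment> \<open>The next element to pass is the largest one below \<open>\<theta>\<close>. It
    exists, as only \<open>l < card S\<close> elements lie above \<open>\<theta>\<close> and
    \<open>\<theta> \<notin> S\<close>.\<close>
  define D where "D = {s \<in> S. s < \<theta>}"
  have "D \<subseteq> S"
    unfolding D_def by blast
  then have "finite D"
    using S by (rule finite_subset)
  moreover have "D \<noteq> {}"
  proof
    assume "D = {}"
    have "\<theta> < s" if "s \<in> S" for s
    proof -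
      have "s \<noteq> \<theta>" "\<not> s < \<theta>"
        using \<theta>(1) \<open>D = {}\<close> that unfolding D_def by blast+
      then show ?thesis by simp
    qed
    then have "{s \<in> S. \<theta> < s} = S"
      by blast
    then show False
      using \<theta>(2) Suc.prems by simp
  qed
  ultimately have m: "Max D \<in> D" "\<And>s. s \<in> D \<Longrightarrow> s \<le> Max D"
    by simp_all
  define m where "m = Max D"
  \<comment> \<open>The predecessor of \<open>m\<close> in \<open>S\<close>, or \<open>m - 1\<close>
    as a default. The midpoint of \<open>M\<close> and \<open>m\<close> is the new threshold, so
    exactly \<open>m\<close> is gained.\<close>
  define M where "M = Max (insert (m - 1) {s \<in> S. s < m})"
  have "M \<in> insert (m - 1) {s \<in> S. s < m}"
    unfolding M_def by (rule Max_in) (use S in simp_all)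
  then have "M < m"
    by auto
  have M_ge: "s \<le> M" if "s \<in> S" "s < m" for s
    unfolding M_def by (rule Max_ge) (use S that in simp_all)
  define \<theta>' where "\<theta>' = (M + m) / 2"
  have \<theta>': "M < \<theta>'" "\<theta>' < m"
    using \<open>M < m\<close> by (simp_all add: \<theta>'_def)
  have mS: "m \<in> S" "m < \<theta>"
    using m(1) by (simp_all add: m_def D_def)
  have cases: "s \<le> M \<or> s = m \<or> \<theta> < s" if "s \<in> S" for s
  proof (cases "s < \<theta>")
    case True
    then have "s \<le> m"
      using m(2)[of s] that unfolding D_def m_def by blast
    then show ?thesis
      using M_ge[OF that] by linarith
  next
    case False
    moreover have "s \<noteq> \<theta>"
      using \<theta>(1) that by blast
    ultimately show ?thesis
      by linarith
  qed
  have "{s \<in> S. \<theta>' < s} = insert m {s \<in> S. \<theta> < s}"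
  proof (intro equalityI subsetI)
    fix s assume "s \<in> {s \<in> S. \<theta>' < s}"
    then show "s \<in> insert m {s \<in> S. \<theta> < s}"
      using cases[of s] \<theta>'(1) by auto
  next
    fix s assume "s \<in> insert m {s \<in> S. \<theta> < s}"
    then show "s \<in> {s \<in> S. \<theta>' < s}"
      using mS \<theta>'(2) by auto
  qed
  then have "card {s \<in> S. \<theta>' < s} = Suc l"
    using S mS(2) \<theta>(2) by simp
  moreover have "\<theta>' \<notin> S"
    using cases[of \<theta>'] \<theta>' mS(2) by linarith
  ultimately show ?case by blast
qed

text \<open>Both are upper sets of the same order on \<open>S\<close>, hence nested: witnesses
  against both inclusions would be ordered oppositely by \<open>f\<close> and \<open>g\<close>.
  Nested finite sets of equal size coincide.\<close>

lemma upper_set_eqI: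
  fixes f g :: "'a \<Rightarrow> real"
  assumes S: "finite S"
    and order: "\<And>j k. j \<in> S \<Longrightarrow> k \<in> S \<Longrightarrow> f j < f k \<longleftrightarrow> g j < g k"
    and card: "card {j \<in> S. s < f j} = card {j \<in> S. t < g j}"
  shows "{j \<in> S. s < f j} = {j \<in> S. t < g j}"
proof -
  have "{j \<in> S. s < f j} \<subseteq> {j \<in> S. t < g j} \<or> {j \<in> S. t < g j} \<subseteq> {j \<in> S. s < f j}"
  proof (rule ccontr)
    assume "\<not> ?thesis"
    then obtain j k where "j \<in> S" "s < f j" "\<not> t < g j" "k \<in> S" "t < g k" "\<not> s < f k"
      by blast
    then show False
      using order[of k j] by linarith
  qed
  then show ?thesis
  proof
    assume "{j \<in> S. s < f j} \<subseteq> {j \<in> S. t < g j}"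
    with card show ?thesis
      using S by (intro card_subset_eq) simp_all
  next
    assume "{j \<in> S. t < g j} \<subseteq> {j \<in> S. s < f j}"
    with card show ?thesis
      using S by (intro card_subset_eq[symmetric]) simp_all
  qed
qed

section \<open>Components of the complement and signs of the linear forms\<close>

text \<open>Intermediate value theorem: the image of \<open>T\<close> is connected and misses
  0.\<close>

lemma connectedin_nonvanishing_sign:
  assumes T: "connectedin X T" and f: "continuous_map X euclideanreal f"
    and nz: "\<And>x. x \<in> topspace X \<Longrightarrow> f x \<noteq> 0" and p: "p \<in> T" and q: "q \<in> T"
  shows "f p < 0 \<longleftrightarrow> f q < 0"
proof -
  have "connected (f ` T)"
    using connectedin_continuous_map_image[OF f T] by simp
  then have "{f a..f b} \<subseteq> f ` T" if "a \<in> T" "b \<in> T" for a b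
    using that by (intro connected_contains_Icc) auto
  moreover have "0 \<notin> f ` T"
    using nz connectedin_subset_topspace[OF T] by (metis imageE subsetD)
  ultimately have "\<not> (f a \<le> 0 \<and> 0 \<le> f b)" if "a \<in> T" "b \<in> T" for a b
    using that by (metis atLeastAtMost_iff subsetD)
  from this[OF p q] this[OF q p] show ?thesis
    by linarith
qed

definition HS_complement :: "nat \<Rightarrow> (nat \<Rightarrow> real) set" where
  "HS_complement n = topspace (Euclidean_space (2 * n - 1)) - \<Union>(HS_arrangement n)"

abbreviation HS_space :: "nat \<Rightarrow> (nat \<Rightarrow> real) topology" where
  "HS_space n \<equiv> subtopology (Euclidean_space (2 * n - 1)) (HS_complement n)"

text \<open>On the complement no form vanishes, so one strict inequality per hyperplane records the
  side.\<close>

definition same_side :: "nat \<Rightarrow> (nat \<Rightarrow> real) \<Rightarrow> (nat \<Rightarrow> real) \<Rightarrow> bool" where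
  "same_side n p q \<longleftrightarrow> (\<forall>i j. 1 \<le> i \<and> i < j \<and> j \<le> n \<longrightarrow>
     (xcoord p i < xcoord p j \<longleftrightarrow> xcoord q i < xcoord q j) \<and>
     (xcoord p i - xcoord p j < ycoord n p i \<longleftrightarrow> xcoord q i - xcoord q j < ycoord n q i))"

lemma mem_HS_complement:
  "p \<in> HS_complement n \<longleftrightarrow> p \<in> topspace (Euclidean_space (2 * n - 1)) \<and>
     (\<forall>i j. 1 \<le> i \<and> i < j \<and> j \<le> n \<longrightarrow>
       xcoord p i - xcoord p j \<noteq> 0 \<and> xcoord p i - xcoord p j \<noteq> ycoord n p i)"
  unfolding HS_complement_def HS_arrangement_def by blast

lemma topspace_HS_space: "topspace (HS_space n) = HS_complement n"
  by (auto simp: HS_complement_def)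

lemma continuous_map_HS_space_coordinate:
  "continuous_map (HS_space n) euclideanreal (\<lambda>p. p k)"
  unfolding Euclidean_space_def
  by (intro continuous_map_from_subtopology continuous_map_product_projection UNIV_I)

lemma connected_component_of_imp_same_side:
  assumes "connected_component_of (HS_space n) p q"
  shows "same_side n p q"
proof -
  obtain T where T: "connectedin (HS_space n) T" "p \<in> T" "q \<in> T"
    using assms unfolding connected_component_of_def by blast
  have *: "f p < 0 \<longleftrightarrow> f q < 0"
    if "continuous_map (HS_space n) euclideanreal f" "\<And>r. r \<in> HS_complement n \<Longrightarrow> f r \<noteq> 0" for f
  proof (rule connectedin_nonvanishing_sign[OF T(1) that(1) _ T(2,3)])
    show "f r \<noteq> 0" if "r \<in> topspace (HS_space n)" for r
      using that \<open>\<And>r. r \<in> HS_complement n \<Longrightarrow> f r \<noteq> 0\<close> unfolding topspace_HS_space by blast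
  qed
  have cont_x: "continuous_map (HS_space n) euclideanreal (\<lambda>r. xcoord r i)"
    and cont_y: "continuous_map (HS_space n) euclideanreal (\<lambda>r. ycoord n r i)" for i
    unfolding xcoord_def ycoord_def by (rule continuous_map_HS_space_coordinate)+
  have "(xcoord p i < xcoord p j \<longleftrightarrow> xcoord q i < xcoord q j) \<and>
     (xcoord p i - xcoord p j < ycoord n p i \<longleftrightarrow> xcoord q i - xcoord q j < ycoord n q i)"
    if ij: "1 \<le> i \<and> i < j \<and> j \<le> n" for i j
  proof -
    have nz: "xcoord r i - xcoord r j \<noteq> 0" "xcoord r i - xcoord r j - ycoord n r i \<noteq> 0"
      if "r \<in> HS_complement n" for r
      using that ij unfolding mem_HS_complement by (metis eq_iff_diff_eq_0)+
    have "xcoord p i - xcoord p j < 0 \<longleftrightarrow> xcoord q i - xcoord q j < 0"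
      by (rule *[OF continuous_map_diff[OF cont_x cont_x] nz(1)])
    moreover have "xcoord p i - xcoord p j - ycoord n p i < 0 \<longleftrightarrow> xcoord q i - xcoord q j - ycoord n q i < 0"
      by (rule *[OF continuous_map_diff[OF continuous_map_diff[OF cont_x cont_x] cont_y] nz(2)])
    ultimately show ?thesis
      by linarith
  qed
  then show ?thesis
    unfolding same_side_def by blast
qed

lemma convex_combination_nonzero:
  fixes u v t :: real
  assumes "u \<noteq> 0" "v \<noteq> 0" "u < 0 \<longleftrightarrow> v < 0" "0 \<le> t" "t \<le> 1"
  shows "(1 - t) * u + t * v \<noteq> 0"
proof (cases "t = 0 \<or> t = 1")
  case False
  then have t: "0 < t" "0 < 1 - t"
    using assms by auto
  show ?thesis
  proof (cases "u < 0")
    case True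
    then have "(1 - t) * u < 0" "t * v < 0"
      using t assms(3) by (simp_all add: mult_pos_neg)
    then show ?thesis by linarith
  next
    case False
    then have "0 < (1 - t) * u" "0 < t * v"
      using t assms(1-3) by simp_all
    then show ?thesis by linarith
  qed
qed (use assms in auto)

text \<open>Along the segment \<open>\<gamma>\<close> each form is a convex combination of two
  nonzero values of equal sign, so the segment is a connected subset of the complement.\<close>

lemma same_side_imp_connected_component_of:
  assumes p: "p \<in> HS_complement n" and q: "q \<in> HS_complement n" and pq: "same_side n p q"
  shows "connected_component_of (HS_space n) p q"
proof -
  define \<gamma> where "\<gamma> t k = (1 - t) * p k + t * q k" for t :: real and k
  have "\<gamma> t \<in> HS_complement n" if t: "t \<in> {0..1}" for t
    unfolding mem_HS_complement
  proof (intro conjI allI impI)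
    show "\<gamma> t \<in> topspace (Euclidean_space (2 * n - 1))"
      using p q unfolding mem_HS_complement topspace_Euclidean_space by (simp add: \<gamma>_def)
    fix i j assume ij: "1 \<le> i \<and> i < j \<and> j \<le> n"
    let ?xp = "xcoord p i - xcoord p j" and ?xq = "xcoord q i - xcoord q j"
    have "xcoord (\<gamma> t) i - xcoord (\<gamma> t) j = (1 - t) * ?xp + t * ?xq"
      by (simp add: xcoord_def \<gamma>_def algebra_simps)
    moreover have "(1 - t) * ?xp + t * ?xq \<noteq> 0"
      using t ij p q pq unfolding mem_HS_complement same_side_def
      by (intro convex_combination_nonzero) auto
    ultimately show "xcoord (\<gamma> t) i - xcoord (\<gamma> t) j \<noteq> 0"
      by simp
    let ?yp = "?xp - ycoord n p i" and ?yq = "?xq - ycoord n q i"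
    have "xcoord (\<gamma> t) i - xcoord (\<gamma> t) j - ycoord n (\<gamma> t) i = (1 - t) * ?yp + t * ?yq"
      by (simp add: xcoord_def ycoord_def \<gamma>_def algebra_simps)
    moreover have "(1 - t) * ?yp + t * ?yq \<noteq> 0"
      using t ij p q pq unfolding mem_HS_complement same_side_def
      by (intro convex_combination_nonzero) auto
    ultimately show "xcoord (\<gamma> t) i - xcoord (\<gamma> t) j \<noteq> ycoord n (\<gamma> t) i"
      by simp
  qed
  then have in_complement: "\<gamma> ` {0..1} \<subseteq> HS_complement n"
    by blast
  \<comment> \<open>\<open>Euclidean_space\<close> is a subspace of a product of real lines, so
    continuity is checked coordinatewise; then the image is placed in the two nested
    subspaces.\<close>
  have "continuous_map (top_of_set {0..1}) euclideanreal (\<lambda>t. \<gamma> t k)" for k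
    unfolding \<gamma>_def continuous_map_iff_continuous by (intro continuous_intros)
  then have "continuous_map (top_of_set {0..1}) (powertop_real UNIV) \<gamma>"
    by (simp add: continuous_map_componentwise_UNIV)
  moreover have "HS_complement n \<subseteq> {x. \<forall>i\<ge>2 * n - 1. x i = 0}"
    unfolding HS_complement_def topspace_Euclidean_space by blast
  then have "\<gamma> \<in> topspace (top_of_set {0..1}) \<rightarrow> {x. \<forall>i\<ge>2 * n - 1. x i = 0}"
    "\<gamma> \<in> topspace (top_of_set {0..1}) \<rightarrow> HS_complement n"
    using in_complement unfolding topspace_euclidean_subtopology by blast+
  ultimately have "continuous_map (top_of_set {0..1}) (HS_space n) \<gamma>"
    unfolding Euclidean_space_def continuous_map_in_subtopology by blast
  then have "connectedin (HS_space n) (\<gamma> ` {0..1})"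
    by (rule connectedin_continuous_map_image) (simp add: connectedin_subtopology)
  moreover have "\<gamma> 0 = p" "\<gamma> 1 = q"
    by (auto simp: \<gamma>_def)
  then have "p \<in> \<gamma> ` {0..1}" "q \<in> \<gamma> ` {0..1}"
    by force+
  ultimately show ?thesis
    unfolding connected_component_of_def by blast
qed

section \<open>The bijection with pairs of permutations\<close>

definition threshold_set :: "nat \<Rightarrow> (nat \<Rightarrow> real) \<Rightarrow> nat \<Rightarrow> nat set" where
  "threshold_set n p i = {j. i < j \<and> j \<le> n \<and> ycoord n p i > xcoord p i - xcoord p j}"

text \<open>In this form the set counted by \<open>region_ell\<close> is visibly an upper set of
  \<open>{i<..n}\<close> ordered by the \<open>x\<close>-coordinates, with threshold
  \<open>x\<^sub>i - y\<^sub>i\<close>.\<close>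

lemma threshold_set_altdef:
  "threshold_set n p i = {j \<in> {i<..n}. xcoord p i - ycoord n p i < xcoord p j}"
  unfolding threshold_set_def by auto

lemma card_threshold_set_le: "card (threshold_set n p i) \<le> n - i"
proof -
  have "card (threshold_set n p i) \<le> card {i<..n}"
    unfolding threshold_set_altdef by (intro card_mono) auto
  then show ?thesis by simp
qed

lemma same_side_threshold_set:
  assumes "same_side n p q" "1 \<le> i"
  shows "threshold_set n p i = threshold_set n q i"
  using assms unfolding threshold_set_def same_side_def by blast

text \<open>\<open>same_side\<close> compares only pairs \<open>i < j\<close>; for the reversed
  pairs the differences must be nonzero, whence membership in the complement.\<close>

lemma same_side_xcoord_less_iff:
  assumes pq: "same_side n p q" and p: "p \<in> HS_complement n" and q: "q \<in> HS_complement n"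
    and ab: "a \<in> {1..n}" "b \<in> {1..n}"
  shows "xcoord p a < xcoord p b \<longleftrightarrow> xcoord q a < xcoord q b"
proof -
  have less: "xcoord p i < xcoord p j \<longleftrightarrow> xcoord q i < xcoord q j"
    and neq: "xcoord p i - xcoord p j \<noteq> 0" "xcoord q i - xcoord q j \<noteq> 0"
    if "i < j" "i \<in> {1..n}" "j \<in> {1..n}" for i j
  proof -
    have "1 \<le> i \<and> i < j \<and> j \<le> n"
      using that by simp
    then show "xcoord p i < xcoord p j \<longleftrightarrow> xcoord q i < xcoord q j"
      "xcoord p i - xcoord p j \<noteq> 0" "xcoord q i - xcoord q j \<noteq> 0"
      using pq p q unfolding same_side_def mem_HS_complement by blast+
  qed
  consider "a < b" | "a = b" | "b < a"
    by linarith
  then show ?thesis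
  proof cases
    case 1
    then show ?thesis using less ab by blast
  next
    case 2
    then show ?thesis by simp
  next
    case 3
    then show ?thesis
      using less[OF 3 ab(2,1)] neq[OF 3 ab(2,1)] by linarith
  qed
qed

lemma inj_on_xcoord:
  assumes "p \<in> HS_complement n"
  shows "inj_on (xcoord p) {1..n}"
proof (rule linorder_inj_onI)
  show "xcoord p i \<noteq> xcoord p j" if "i < j" "i \<in> {1..n}" "j \<in> {1..n}" for i j
  proof -
    have "1 \<le> i \<and> i < j \<and> j \<le> n"
      using that by simp
    then have "xcoord p i - xcoord p j \<noteq> 0"
      using assms unfolding mem_HS_complement by blast
    then show ?thesis by simp
  qed
qed (rule nat_le_linear)

lemma sorting_permutation_cong:
  assumes pq: "\<And>a b. a \<in> {1..n} \<Longrightarrow> b \<in> {1..n} \<Longrightarrow> f a < f b \<longleftrightarrow> g a < g b"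
    and f: "sorting_permutation n f \<sigma>"
  shows "sorting_permutation n g \<sigma>"
  unfolding sorting_permutation_def
proof (intro conjI allI impI)
  show \<sigma>: "\<sigma> permutes {1..n}"
    using f by (rule sorting_permutation_permutes)
  fix i j assume ij: "1 \<le> i \<and> i < j \<and> j \<le> n"
  then have "i \<in> {1..n}" "j \<in> {1..n}"
    by auto
  then have "\<sigma> i \<in> {1..n}" "\<sigma> j \<in> {1..n}"
    using permutes_in_image[OF \<sigma>] by blast+
  with pq sorting_permutation_mono[OF f] ij show "g (\<sigma> i) < g (\<sigma> j)"
    by blast
qed

section \<open>Regions as classes of \<open>same_side\<close>, and the values of the map on
  them\<close>

lemma HS_regions_altdef:
  "HS_regions n = (\<lambda>p. {q. connected_component_of (HS_space n) p q}) ` HS_complement n"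
  unfolding HS_regions_def HS_complement_def[symmetric] connected_components_of_def topspace_HS_space ..

lemma mem_HS_component_iff:
  assumes "p \<in> HS_complement n"
  shows "q \<in> {q. connected_component_of (HS_space n) p q} \<longleftrightarrow> q \<in> HS_complement n \<and> same_side n p q"
proof
  assume "q \<in> {q. connected_component_of (HS_space n) p q}"
  then have *: "connected_component_of (HS_space n) p q"
    by (rule CollectD)
  then have "q \<in> topspace (HS_space n)"
    by (rule connected_component_in_topspace[THEN conjunct2])
  then show "q \<in> HS_complement n \<and> same_side n p q"
    using connected_component_of_imp_same_side[OF *] topspace_HS_space by blast
next
  assume "q \<in> HS_complement n \<and> same_side n p q"
  then show "q \<in> {q. connected_component_of (HS_space n) p q}"
    using same_side_imp_connected_component_of[OF assms] by blast
qed

lemma HS_regions_eq: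
  "HS_regions n = (\<lambda>p. {q \<in> HS_complement n. same_side n p q}) ` HS_complement n"
  unfolding HS_regions_altdef
  by (rule image_cong[OF refl], rule set_eqI) (use mem_HS_component_iff in blast)

lemma same_side_refl: "same_side n p p"
  unfolding same_side_def by blast

lemma same_side_sym: "same_side n p q \<Longrightarrow> same_side n q p"
  unfolding same_side_def by blast

lemma same_side_trans: "same_side n p q \<Longrightarrow> same_side n q r \<Longrightarrow> same_side n p r"
  unfolding same_side_def by blast

text \<open>A region is handled through a representative \<open>p\<close>. What is true of
  \<open>p\<close> carries over to all of \<open>A\<close> by \<open>same_side\<close>, and
  \<open>p \<in> A\<close> gives uniqueness, so the definite descriptions can be evaluated at
  \<open>p\<close>.\<close>

context
  fixes n A p
  assumes p: "p \<in> HS_complement n" and A: "A = {q \<in> HS_complement n. same_side n p q}"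
begin

lemma region_sigma_eqI:
  assumes "sorting_permutation n (xcoord p) \<sigma>"
  shows "region_sigma n A = \<sigma>"
proof -
  have sort_q: "sorting_permutation n (xcoord q) \<sigma>" if "q \<in> A" for q
    by (rule sorting_permutation_cong[OF same_side_xcoord_less_iff assms])
       (use that A p in blast)+
  have p_in: "p \<in> A"
    using p A same_side_refl by blast
  show ?thesis
    unfolding region_sigma_def
  proof (rule the_equality)
    show "\<sigma> permutes {1..n} \<and>
      (\<forall>p\<in>A. \<forall>i j. 1 \<le> i \<and> i < j \<and> j \<le> n \<longrightarrow> xcoord p (\<sigma> i) < xcoord p (\<sigma> j))"
      using sort_q assms unfolding sorting_permutation_def by blast
  next
    fix \<sigma>' assume "\<sigma>' permutes {1..n} \<and>
      (\<forall>p\<in>A. \<forall>i j. 1 \<le> i \<and> i < j \<and> j \<le> n \<longrightarrow> xcoord p (\<sigma>' i) < xcoord p (\<sigma>' j))"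
    then have "sorting_permutation n (xcoord p) \<sigma>'"
      using p_in unfolding sorting_permutation_def by blast
    then show "\<sigma>' = \<sigma>"
      using assms by (rule sorting_permutation_unique)
  qed
qed

lemma sorting_permutation_region_sigma: "sorting_permutation n (xcoord p) (region_sigma n A)"
  using ex_sorting_permutation[OF inj_on_xcoord[OF p]] region_sigma_eqI by metis

lemma region_ell_eq:
  assumes i: "1 \<le> i" "i < n"
  shows "region_ell n A i = card (threshold_set n p i)"
proof -
  have "(THE l. \<forall>q\<in>A. l = card (threshold_set n q i)) = card (threshold_set n p i)"
  proof (rule the_equality)
    show "\<forall>q\<in>A. card (threshold_set n p i) = card (threshold_set n q i)"
    proof
      fix q assume "q \<in> A"
      then have "same_side n p q"
        unfolding A by blast
      then show "card (threshold_set n p i) = card (threshold_set n q i)"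
        using same_side_threshold_set[of n p q i] i(1) by simp
    qed
    show "l = card (threshold_set n p i)" if "\<forall>q\<in>A. l = card (threshold_set n q i)" for l
      using that p same_side_refl unfolding A by blast
  qed
  then show ?thesis
    using i unfolding region_ell_def threshold_set_def by (simp only: if_True simp_thms)
qed

lemma region_ell_le: "region_ell n A i \<le> n - i"
proof (cases "1 \<le> i \<and> i < n")
  case True
  then show ?thesis
    using region_ell_eq card_threshold_set_le by simp
next
  case False
  then show ?thesis
    unfolding region_ell_def by (simp only: if_False)
qed

lemma has_lehmer_code_region_tau: "has_lehmer_code n (region_ell n A) (region_tau n A)"
  unfolding region_tau_def using region_ell_le by (rule has_lehmer_code_perm_of_lehmer_code)

end

lemma HS_region_cases:
  assumes "A \<in> HS_regions n"
  obtains p where "p \<in> HS_complement n" "A = {q \<in> HS_complement n. same_side n p q}"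
  using assms unfolding HS_regions_eq by (rule imageE) blast

section \<open>Injectivity and image of the map\<close>

text \<open>From \<open>\<sigma>\<close> one recovers the order of the \<open>x\<close>-coordinates.
  From \<open>\<tau>\<close> one recovers the sizes of the threshold sets and, with that order, the
  sets themselves; together these are all the sides.\<close>

lemma inj_on_region_map: "inj_on (region_map n) (HS_regions n)"
proof (rule inj_onI)
  fix A B assume AB: "A \<in> HS_regions n" "B \<in> HS_regions n" and eq: "region_map n A = region_map n B"
  obtain p where p: "p \<in> HS_complement n" "A = {q \<in> HS_complement n. same_side n p q}"
    using AB(1) by (rule HS_region_cases)
  obtain q where q: "q \<in> HS_complement n" "B = {r \<in> HS_complement n. same_side n q r}"
    using AB(2) by (rule HS_region_cases)
  have sigma: "region_sigma n A = region_sigma n B" and tau: "region_tau n A = region_tau n B"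
    using eq unfolding region_map_def by simp_all
  have less: "xcoord p i < xcoord p j \<longleftrightarrow> xcoord q i < xcoord q j"
    if "i \<in> {1..n}" "j \<in> {1..n}" for i j
    using sorting_permutation_less_iff[OF sorting_permutation_region_sigma[OF p] that]
      sorting_permutation_less_iff[OF sorting_permutation_region_sigma[OF q] that]
    unfolding sigma by blast
  have threshold: "threshold_set n p i = threshold_set n q i" if i: "1 \<le> i" "i < n" for i
  proof -
    have "region_ell n A i = region_ell n B i"
      using has_lehmer_code_inj[OF has_lehmer_code_region_tau[OF p]
          has_lehmer_code_region_tau[OF q, folded tau] _ region_ell_le[OF p] region_ell_le[OF q], of i] i
      by simp
    then have "card (threshold_set n p i) = card (threshold_set n q i)"
      using region_ell_eq[OF p i] region_ell_eq[OF q i] by simp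
    then show ?thesis
      unfolding threshold_set_altdef
      by (intro upper_set_eqI less) (use i in auto)
  qed
  have "same_side n p q"
    unfolding same_side_def
  proof (intro allI impI conjI)
    fix i j assume ij: "1 \<le> i \<and> i < j \<and> j \<le> n"
    then show "xcoord p i < xcoord p j \<longleftrightarrow> xcoord q i < xcoord q j"
      by (intro less) auto
    have "j \<in> threshold_set n p i \<longleftrightarrow> j \<in> threshold_set n q i"
      using threshold[of i] ij by simp
    then show "xcoord p i - xcoord p j < ycoord n p i \<longleftrightarrow> xcoord q i - xcoord q j < ycoord n q i"
      using ij unfolding threshold_set_def by blast
  qed
  then show "A = B"
    using same_side_trans same_side_sym unfolding p(2) q(2) by blast
qed

lemma ex_point_of_sigma_code:
  assumes \<sigma>: "\<sigma> permutes {1..n}" and c: "\<And>i. i \<in> {1..n} \<Longrightarrow> c i \<le> n - i"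
  shows "\<exists>p \<in> HS_complement n. sorting_permutation n (xcoord p) \<sigma> \<and>
    (\<forall>i. 1 \<le> i \<and> i < n \<longrightarrow> card (threshold_set n p i) = c i)"
proof -
  \<comment> \<open>Ranks serve as \<open>x\<close>-coordinates: they are distinct and sorted by
    \<open>\<sigma>\<close>.\<close>
  define x where "x j = real (inv \<sigma> j)" for j
  have inj_x: "inj x"
    unfolding x_def using permutes_inj[OF permutes_inv[OF \<sigma>]] by (simp add: inj_def)
  \<comment> \<open>The threshold \<open>\<theta> i\<close> is to be
    \<open>x\<^sub>i - y\<^sub>i\<close>. Avoiding the later \<open>x\<close>-values keeps the point
    off the hyperplanes \<open>x\<^sub>i - x\<^sub>j = y\<^sub>i\<close>.\<close>
  have "\<exists>\<theta>. \<theta> \<notin> x ` {i<..n} \<and> card {s \<in> x ` {i<..n}. \<theta> < s} = c i" if "i \<in> {1..n}" for i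
    using c[OF that] card_image[OF inj_on_subset[OF inj_x subset_UNIV], of "{i<..n}"]
    by (intro ex_threshold) simp_all
  then have "\<forall>i\<in>{1..n}. \<exists>\<theta>. \<theta> \<notin> x ` {i<..n} \<and> card {s \<in> x ` {i<..n}. \<theta> < s} = c i"
    by blast
  from bchoice[OF this] obtain \<theta>
    where \<theta>: "\<And>i. i \<in> {1..n} \<Longrightarrow> \<theta> i \<notin> x ` {i<..n} \<and> card {s \<in> x ` {i<..n}. \<theta> i < s} = c i"
    by blast
  \<comment> \<open>Coordinates count from 0: \<open>x\<^sub>i\<close> sits at \<open>i - 1\<close>
    and \<open>y\<^sub>i\<close> at \<open>n + i - 1\<close>. From \<open>2 * n - 1\<close> on,
    points of the Euclidean space vanish.\<close>
  define p where "p k = (if k < n then x (k + 1)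
    else if k < 2 * n - 1 then x (k - n + 1) - \<theta> (k - n + 1) else 0)" for k
  have xp: "xcoord p i = x i" if "i \<in> {1..n}" for i
  proof -
    have "i - 1 < n" "i - 1 + 1 = i"
      using that by auto
    then show ?thesis
      unfolding xcoord_def p_def by (simp only: if_True)
  qed
  have yp: "ycoord n p i = x i - \<theta> i" if "1 \<le> i" "i < n" for i
  proof -
    have "\<not> n + i - 1 < n" "n + i - 1 < 2 * n - 1" "n + i - 1 - n + 1 = i"
      using that by linarith+
    then show ?thesis
      unfolding ycoord_def p_def by (simp only: if_True if_False)
  qed
  have "p \<in> HS_complement n"
    unfolding mem_HS_complement
  proof (intro conjI allI impI)
    show "p \<in> topspace (Euclidean_space (2 * n - 1))"
      unfolding topspace_Euclidean_space p_def by auto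
    fix i j assume ij: "1 \<le> i \<and> i < j \<and> j \<le> n"
    then have x_eq: "xcoord p i = x i" "xcoord p j = x j" and y_eq: "ycoord n p i = x i - \<theta> i"
      using xp[of i] xp[of j] yp[of i] by auto
    show "xcoord p i - xcoord p j \<noteq> 0"
      using ij injD[OF inj_x, of i j] unfolding x_eq by auto
    have "\<theta> i \<noteq> x j"
      using \<theta>[of i] ij by auto
    then show "xcoord p i - xcoord p j \<noteq> ycoord n p i"
      unfolding x_eq y_eq by simp
  qed
  moreover have "sorting_permutation n (xcoord p) \<sigma>"
    unfolding sorting_permutation_def
  proof (intro conjI allI impI \<sigma>)
    fix i j assume ij: "1 \<le> i \<and> i < j \<and> j \<le> n"
    then have "\<sigma> i \<in> {1..n}" "\<sigma> j \<in> {1..n}"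
      using permutes_in_image[OF \<sigma>, of i] permutes_in_image[OF \<sigma>, of j] by auto
    then show "xcoord p (\<sigma> i) < xcoord p (\<sigma> j)"
      using ij by (simp only: xp) (simp add: x_def permutes_inverses(2)[OF \<sigma>])
  qed
  moreover have "card (threshold_set n p i) = c i" if i: "1 \<le> i \<and> i < n" for i
  proof -
    have "threshold_set n p i = {j \<in> {i<..n}. \<theta> i < x j}"
      using i xp yp[of i] unfolding threshold_set_altdef by auto
    \<comment> \<open>The thresholds count values, the code counts indices; injectivity of
      \<open>x\<close> identifies the two.\<close>
    then have "x ` threshold_set n p i = {s \<in> x ` {i<..n}. \<theta> i < s}"
      by blast
    moreover have "card (x ` threshold_set n p i) = card (threshold_set n p i)"
      by (rule card_image[OF inj_on_subset[OF inj_x subset_UNIV]])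
    ultimately show ?thesis
      using \<theta>[of i] i by simp
  qed
  ultimately show ?thesis
    by blast
qed

text \<open>For surjectivity, take a Lehmer code of \<open>\<tau>\<close> and a point with order
  \<open>\<sigma>\<close> and these threshold counts; its class is the preimage.\<close>

lemma region_map_image:
  "region_map n ` HS_regions n = {\<sigma>. \<sigma> permutes {1..n}} \<times> {\<tau>. \<tau> permutes {1..n}}"
proof (intro equalityI subsetI)
  fix z assume "z \<in> region_map n ` HS_regions n"
  then obtain A where A: "A \<in> HS_regions n" "z = region_map n A"
    by blast
  obtain p where p: "p \<in> HS_complement n" "A = {q \<in> HS_complement n. same_side n p q}"
    using A(1) by (rule HS_region_cases)
  show "z \<in> {\<sigma>. \<sigma> permutes {1..n}} \<times> {\<tau>. \<tau> permutes {1..n}}"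
    using sorting_permutation_permutes[OF sorting_permutation_region_sigma[OF p]]
      has_lehmer_code_permutes[OF has_lehmer_code_region_tau[OF p]]
    unfolding A(2) region_map_def by blast
next
  fix z :: "(nat \<Rightarrow> nat) \<times> (nat \<Rightarrow> nat)"
  assume "z \<in> {\<sigma>. \<sigma> permutes {1..n}} \<times> {\<tau>. \<tau> permutes {1..n}}"
  then obtain \<sigma> \<tau> where z: "z = (\<sigma>, \<tau>)" and \<sigma>: "\<sigma> permutes {1..n}" and \<tau>: "\<tau> permutes {1..n}"
    by blast
  obtain c where c: "c \<in> (\<Pi>\<^sub>E i\<in>{1..n}. {..n - i})" "has_lehmer_code n c \<tau>"
    using ex_lehmer_code[OF \<tau>] by blast
  have c_le: "c i \<le> n - i" if "i \<in> {1..n}" for i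
    using PiE_mem[OF c(1) that] unfolding atMost_iff .
  obtain p where p: "p \<in> HS_complement n" and sort: "sorting_permutation n (xcoord p) \<sigma>"
    and card: "\<And>i. 1 \<le> i \<and> i < n \<Longrightarrow> card (threshold_set n p i) = c i"
    using ex_point_of_sigma_code[OF \<sigma> c_le] by blast
  define A where A: "A = {q \<in> HS_complement n. same_side n p q}"
  have "region_ell n A i = c i" if i: "i \<in> {1..n}" for i
  proof (cases "i < n")
    case True
    then show ?thesis
      using region_ell_eq[OF p A, of i] card[of i] i by simp
  next
    \<comment> \<open>Here \<open>i = n\<close>, and both codes are bounded by
      \<open>n - i = 0\<close>.\<close>
    case False
    then show ?thesis
      using region_ell_le[OF p A, of i] c_le[OF i] by simp
  qed
  then have "has_lehmer_code n (region_ell n A) \<tau>"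
    by (rule has_lehmer_code_cong[THEN iffD2, OF _ c(2)])
  then have "region_tau n A = \<tau>"
    using has_lehmer_code_region_tau[OF p A] has_lehmer_code_unique by blast
  moreover have "region_sigma n A = \<sigma>"
    using p A sort by (rule region_sigma_eqI)
  moreover have "A \<in> HS_regions n"
    unfolding HS_regions_eq A using p by (rule imageI)
  ultimately show "z \<in> region_map n ` HS_regions n"
    unfolding z region_map_def by blast
qed

section \<open>Evaluation of the signed sum\<close>

theorem corollary5p4:
  fixes n :: nat
  assumes "n \<ge> 1"
  shows "(\<Sum>A\<in>HS_regions n.
            case region_map n A of (\<sigma>, \<tau>) \<Rightarrow> monom (region_sign n A) (cyc n \<sigma> + cyc n \<tau> - 1))
         = monom 1 1 * (\<Prod>i = 1..n - 1. (monom 1 1 - [:int i:]) ^ 2)"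
proof -
  let ?P = "{\<sigma>. \<sigma> permutes {1..n}}" and ?X = "monom 1 1 :: int poly"
  let ?g = "\<lambda>(\<sigma>, \<tau>). monom (sign \<sigma> * sign \<tau> :: int) (cyc n \<sigma> + cyc n \<tau> - 1)"
  let ?S = "\<Sum>A\<in>HS_regions n. case region_map n A of (\<sigma>, \<tau>) \<Rightarrow>
    monom (region_sign n A) (cyc n \<sigma> + cyc n \<tau> - 1)"
  \<comment> \<open>Since \<open>n \<ge> 1\<close> there is at least one cycle, so the
    \<open>- 1\<close> in the exponent is not truncated. Multiplying by \<open>?X\<close> removes it
    and makes each summand a product over \<open>\<sigma>\<close> and \<open>\<tau>\<close>.\<close>
  have cyc_pos: "0 < cyc n \<sigma>" for \<sigma>
    unfolding cyc_def card_gt_0_iff using assms by simp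
  have "?S = (\<Sum>A\<in>HS_regions n. ?g (region_map n A))"
    unfolding region_sign_def by (intro sum.cong refl) (simp add: split_beta)
  also have "\<dots> = (\<Sum>z\<in>?P \<times> ?P. ?g z)"
    unfolding region_map_image[symmetric] sum.reindex[OF inj_on_region_map] comp_def ..
  finally have "?X * ?S = (\<Sum>z\<in>?P \<times> ?P. ?X * ?g z)"
    by (simp only: sum_distrib_left)
  also have "\<dots> = (\<Sum>(\<sigma>, \<tau>)\<in>?P \<times> ?P. monom (sign \<sigma>) (cyc n \<sigma>) * monom (sign \<tau>) (cyc n \<tau>))"
  proof (intro sum.cong refl)
    fix z :: "(nat \<Rightarrow> nat) \<times> (nat \<Rightarrow> nat)"
    obtain \<sigma> \<tau> where z: "z = (\<sigma>, \<tau>)"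
      by (rule prod.exhaust)
    show "?X * ?g z = (case z of (\<sigma>, \<tau>) \<Rightarrow> monom (sign \<sigma>) (cyc n \<sigma>) * monom (sign \<tau>) (cyc n \<tau>))"
      using cyc_pos[of \<sigma>] unfolding z by (simp add: mult_monom)
  qed
  also have "\<dots> = (\<Sum>\<sigma>\<in>?P. monom (sign \<sigma>) (cyc n \<sigma>)) ^ 2"
    by (simp only: sum.cartesian_product[symmetric] sum_product power2_eq_square)
  also have "(\<Sum>\<sigma>\<in>?P. monom (sign \<sigma>) (cyc n \<sigma>)) = (\<Prod>i<n. ?X - [:int i:])"
    unfolding cyc_def using sum_sign_monom_card_orbits[of "{1..n}"] by simp
  \<comment> \<open>The factor for \<open>i = 0\<close> is \<open>?X\<close>. Squaring yields two of
    these, one of which cancels against the auxiliary \<open>?X\<close>.\<close>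
  also have "\<dots> = ?X * (\<Prod>i = 1..n - 1. ?X - [:int i:])"
  proof -
    have "{..<n} = insert 0 {1..n - 1}"
      using assms by auto
    then show ?thesis
      by simp
  qed
  finally have "?X * ?S = ?X * (?X * (\<Prod>i = 1..n - 1. (?X - [:int i:]) ^ 2))"
    by (simp only: prod_power_distrib power_mult_distrib) (simp only: power2_eq_square mult.assoc)
  moreover have "?X \<noteq> 0"
    by simp
  ultimately show ?thesis
    by (rule mult_left_cancel[THEN iffD1, rotated])
qed

end
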